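(* Let $\mathcal{D}\subset\mathbb{R}^d$ be a compact convex set and let $k$ be the squared exponential kernel $k(x_1,x_2)=M_k^2\exp(-\|x_2-x_1\|_2^2/(2l^2))$. Let $(f_t)_{t\ge1}$, $f_t:\mathcal{D}\to\mathbb{R}$, be a sequence of reward functions such that (i) for all $t$, $f_t$ lies in the RKHS $\mathcal{H}_k$ with $\|f_t\|_k\le B$, and (ii) there is $\alpha\ge0$ such that for all $t_1<t_2$, $f_{t_1}(x)=f_{t_2}(x)+v_{t_1,t_2}$ with $v_{t_1,t_2}$ zero-mean sub-Gaussian of variance $\sigma^2(t_2-t_1)^\alpha$, independent across times. Fix a horizon $T$, and suppose that, relative to the target $f_T$, each main observation satisfies $y_t=f_T(x_t)+\epsilon_t$ with $\epsilon_t\sim\mathcal{N}(0,\sigma^2(1+(T-t)^\alpha))$, where $\alpha>1$. Consider any online algorithm $\pi$ that, at each step $t$, selects a main evaluation point $x_t$ and may additionally perform $n_t\ge0$ side queries (at arbitrary points of $\mathcal{D}$), for a total of $N_T=\sum_{t=1}^T n_t$ additional queries up to time $T$. If $$N_T=\mathcal{O}\big(T^{\frac{\alpha}{\alpha+1}}\big),$$ then the expected cumulative dynamic regret $R_T=\sum_{t=1}^T\big(f_t(x_t^* )-f_t(x_t)\big)$, with $x_t^*=\arg\max_{x\in\mathcal{D}}f_t(x)$, satisfies (in the minimax sense over such instances) $$\mathbb{E}[R_T]\ge\Omega(T).$$ In particular, any algorithm with $N_T=\mathcal{O}(T^{\alpha/(\alpha+1)})$ side queries cannot guarantee sublinear 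regret.
   Context: Time-varying Gaussian process bandit optimization in the frequentist setting, where temporal variation is modeled by uncertainty injection: past observations become noisier the further back in time they are, with variance growing as $(T-t)^\alpha$. The learner may supplement bandit feedback with additional (side) queries. *)

theory Defs
  imports "HOL-Probability.Probability"
begin

definition se_kernel :: "real \<Rightarrow> real \<Rightarrow> real ^ 'n \<Rightarrow> real ^ 'n \<Rightarrow> real" where
  "se_kernel Mk l x1 x2 = Mk\<^sup>2 * exp (- (norm (x2 - x1))\<^sup>2 / (2 * l\<^sup>2))"

text \<open>An element of the pre-Hilbert space span of kernel sections is a finite list of
  (coefficient, centre) pairs, representing the function sum_i c_i k(., x_i).\<close>

definition pre_eval :: "('a \<Rightarrow> 'a \<Rightarrow> real) \<Rightarrow> (real \<times> 'a) list \<Rightarrow> 'a \<Rightarrow> real" where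
  "pre_eval k g x = (\<Sum>i<length g. fst (g ! i) * k (snd (g ! i)) x)"

definition pre_norm :: "('a \<Rightarrow> 'a \<Rightarrow> real) \<Rightarrow> (real \<times> 'a) list \<Rightarrow> real" where
  "pre_norm k g = sqrt (\<Sum>i<length g. \<Sum>j<length g.
       fst (g ! i) * fst (g ! j) * k (snd (g ! i)) (snd (g ! j)))"

definition pre_diff :: "(real \<times> 'a) list \<Rightarrow> (real \<times> 'a) list \<Rightarrow> (real \<times> 'a) list" where
  "pre_diff g h = g @ map (\<lambda>(c, x). (- c, x)) h"

text \<open>Moore-Aronszajn: f lies in the RKHS H_k(D) iff it is the pointwise limit on D of a
  Cauchy sequence (in the pre-norm) of finite kernel expansions with centres in D; its RKHS norm
  is the limit of the pre-norms. Hence "f in H_k and norm of f at most B".\<close>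

definition in_rkhs_ball :: "('a \<Rightarrow> 'a \<Rightarrow> real) \<Rightarrow> 'a set \<Rightarrow> real \<Rightarrow> ('a \<Rightarrow> real) \<Rightarrow> bool" where
  "in_rkhs_ball k D B f \<longleftrightarrow>
     (\<exists>g :: nat \<Rightarrow> (real \<times> 'a) list. \<exists>L.
        (\<forall>n. \<forall>p \<in> set (g n). snd p \<in> D) \<and>
        (\<forall>e>0. \<exists>N. \<forall>m\<ge>N. \<forall>n\<ge>N. pre_norm k (pre_diff (g m) (g n)) < e) \<and>
        (\<forall>x\<in>D. (\<lambda>n. pre_eval k (g n) x) \<longlonglongrightarrow> f x) \<and>
        (\<lambda>n. pre_norm k (g n)) \<longlonglongrightarrow> L \<and> L \<le> B)"

text \<open>A history is a list of queries (is_main, point, observed value). A (randomised) algorithm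
  maps a random seed u and the history so far to the next query (is_main, point): either a side
  query or the main evaluation of the current step. The current step is 1 + number of main
  evaluations made so far.\<close>

type_synonym 'a hist = "(bool \<times> 'a \<times> real) list"

definition n_main :: "'a hist \<Rightarrow> nat" where
  "n_main h = length (filter fst h)"

definition main_points :: "'a hist \<Rightarrow> 'a list" where
  "main_points h = map (\<lambda>e. fst (snd e)) (filter fst h)"

definition noise_sd :: "real \<Rightarrow> real \<Rightarrow> nat \<Rightarrow> nat \<Rightarrow> real" where
  "noise_sd \<sigma> \<alpha> T t = sqrt (\<sigma>\<^sup>2 * (1 + (real T - real t) powr \<alpha>))"

text \<open>Interaction run: z j is the j-th i.i.d. standard normal variable, used as noise of the
  j-th query; observations are y = f_T(x) + noise. The run stops once T main evaluations are done.\<close>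

fun interact :: "real \<Rightarrow> real \<Rightarrow> nat \<Rightarrow> ('a \<Rightarrow> real) \<Rightarrow> (real \<Rightarrow> 'a hist \<Rightarrow> bool \<times> 'a)
                 \<Rightarrow> real \<Rightarrow> (nat \<Rightarrow> real) \<Rightarrow> nat \<Rightarrow> 'a hist" where
  "interact \<sigma> \<alpha> T f alg u z 0 = []"
| "interact \<sigma> \<alpha> T f alg u z (Suc j) =
     (let h = interact \<sigma> \<alpha> T f alg u z j in
      if n_main h \<ge> T then h
      else (let a = alg u h; t = Suc (n_main h) in
            h @ [(fst a, snd a, f (snd a) + noise_sd \<sigma> \<alpha> T t * z j)]))"

definition max_queries :: "nat \<Rightarrow> real \<Rightarrow> nat" where
  "max_queries T budget = T + nat \<lfloor>budget\<rfloor>"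

definition final_hist :: "real \<Rightarrow> real \<Rightarrow> nat \<Rightarrow> real \<Rightarrow> ('a \<Rightarrow> real)
                           \<Rightarrow> (real \<Rightarrow> 'a hist \<Rightarrow> bool \<times> 'a) \<Rightarrow> real \<Rightarrow> (nat \<Rightarrow> real) \<Rightarrow> 'a hist" where
  "final_hist \<sigma> \<alpha> T budget f alg u z = interact \<sigma> \<alpha> T f alg u z (max_queries T budget)"

definition regret :: "'a set \<Rightarrow> ('a \<Rightarrow> real) \<Rightarrow> nat \<Rightarrow> 'a hist \<Rightarrow> real" where
  "regret D f T h = (\<Sum>i<T. (SUP x\<in>D. f x) - f (main_points h ! i))"

definition noise_space :: "(real \<times> (nat \<Rightarrow> real)) measure" where
  "noise_space = uniform_measure lborel {0..1} \<Otimes>\<^sub>M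
                 (\<Pi>\<^sub>M j\<in>UNIV. density lborel std_normal_density)"

text \<open>Valid algorithm for horizon T with side-query budget: it only queries points of D, and for
  every admissible instance and every realisation of the randomness, the T main evaluations are
  completed with at most budget side queries (i.e. within max_queries steps); moreover the regret
  is a random variable (so its expectation is defined).\<close>

definition valid_alg :: "'a set \<Rightarrow> ('a \<Rightarrow> 'a \<Rightarrow> real) \<Rightarrow> real \<Rightarrow> real \<Rightarrow> real \<Rightarrow> nat \<Rightarrow> real
                         \<Rightarrow> (real \<Rightarrow> 'a hist \<Rightarrow> bool \<times> 'a) \<Rightarrow> bool" where
  "valid_alg D k B \<sigma> \<alpha> T budget alg \<longleftrightarrow>
     (\<forall>u h. snd (alg u h) \<in> D) \<and>
     (\<forall>f. in_rkhs_ball k D B f \<longrightarrow>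
        (\<forall>u z. n_main (final_hist \<sigma> \<alpha> T budget f alg u z) = T) \<and>
        (\<lambda>(u, z). regret D f T (final_hist \<sigma> \<alpha> T budget f alg u z)) \<in> borel_measurable noise_space)"

end

theory Submission
  imports Defs
begin

text \<open>Le Cam's two-point method applied to the first half of the horizon only. There every
  observation has noise variance at least of order \<open>T\<^sup>\<alpha>\<close>, while at most \<open>O(T)\<close> queries are made,
  so the total information separating two fixed instances is \<open>O(T\<^bsup>1 - \<alpha>\<^esup>)\<close>, hence bounded. Two
  instances with different maximisers therefore cannot be told apart, and one of them costs linear
  regret before time \<open>T / 2\<close>, however informative later side queries are.\<close>

abbreviation std_normal :: "real measure" where
  "std_normal \<equiv> density lborel std_normal_density"

abbreviation normal_seq :: "(nat \<Rightarrow> real) measure" where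
  "normal_seq \<equiv> \<Pi>\<^sub>M j\<in>UNIV. std_normal"

lemma prob_space_std_normal: "prob_space std_normal"
  by (rule prob_space_normal_density) simp

lemma sequence_space_std_normal: "sequence_space std_normal"
proof -
  interpret prob_space std_normal by (rule prob_space_std_normal)
  show ?thesis by unfold_locales
qed

lemma prob_space_normal_seq: "prob_space normal_seq"
  by (intro prob_space_PiM prob_space_std_normal)

lemma integral_normal_seq_Cons:
  fixes f :: "(nat \<Rightarrow> real) \<Rightarrow> real"
  assumes [measurable]: "f \<in> borel_measurable normal_seq" and bnd: "\<And>z. \<bar>f z\<bar> \<le> b"
  shows "(\<integral>z. f z \<partial>normal_seq) = (\<integral>s. (\<integral>z. f (case_nat s z) \<partial>normal_seq) \<partial>std_normal)"
proof -
  interpret sequence_space std_normal by (rule sequence_space_std_normal)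
  interpret G: prob_space std_normal by (rule prob_space_std_normal)
  interpret S: prob_space normal_seq by (rule prob_space_normal_seq)
  interpret P: pair_prob_space std_normal normal_seq ..
  have "integrable (std_normal \<Otimes>\<^sub>M normal_seq) (\<lambda>(s, z). f (case_nat s z))"
    by (rule P.integrable_const_bound[where B = b]) (auto simp: bnd)
  from P.integral_fst'[OF this]
  have "(\<integral>s. (\<integral>z. f (case_nat s z) \<partial>normal_seq) \<partial>std_normal)
        = (\<integral>\<omega>. f (case_nat (fst \<omega>) (snd \<omega>)) \<partial>(std_normal \<Otimes>\<^sub>M normal_seq))"
    by (simp add: case_prod_beta')
  also have "\<dots> = (\<integral>z. f z \<partial>distr (std_normal \<Otimes>\<^sub>M normal_seq) normal_seq (\<lambda>(s, z). case_nat s z))"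
    by (subst integral_distr) (auto simp: case_prod_beta')
  also have "\<dots> = (\<integral>z. f z \<partial>normal_seq)"
    by (subst PiM_iter) simp
  finally show ?thesis by simp
qed

lemma normal_density_shift_sq:
  "(normal_density a 1 s)\<^sup>2 = exp (a\<^sup>2) * normal_density (2 * a) 1 s * std_normal_density s"
  by (simp add: normal_density_def power_mult_distrib power_divide field_simps
        flip: exp_add exp_double) (simp add: power2_eq_square algebra_simps)

text \<open>One step of the change of measure: Cauchy--Schwarz with the second moment
  \<^term>\<open>exp (a\<^sup>2)\<close> of the likelihood ratio of the shifted Gaussian.\<close>

lemma std_normal_shift_bound:
  fixes A B :: "real \<Rightarrow> real"
  assumes [measurable]: "A \<in> borel_measurable borel" "B \<in> borel_measurable borel"
    and A: "\<And>s. 0 \<le> A s" "\<And>s. A s \<le> 1" and B: "\<And>s. 0 \<le> B s" "\<And>s. B s \<le> 1"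
    and AB: "\<And>s. (A s)\<^sup>2 \<le> K * B (s + a)"
  shows "(\<integral>s. A s \<partial>std_normal)\<^sup>2 \<le> exp (a\<^sup>2) * K * (\<integral>s. B s \<partial>std_normal)"
proof -
  define I where "I = (\<integral>s. A s \<partial>std_normal)"
  define J where "J = (\<integral>s. B s \<partial>std_normal)"
  define c where "c = I * exp (- a\<^sup>2)"
  have int: "integrable lborel (\<lambda>s. normal_density m 1 s * F s)"
    if [measurable]: "F \<in> borel_measurable borel" and F: "\<And>s. 0 \<le> F s" "\<And>s. F s \<le> 1" for F m
    by (rule Bochner_Integration.integrable_bound[OF integrable_normal_density[of 1 m]])
       (auto simp: F mult_left_le)
  have I: "I = (\<integral>s. normal_density a 1 s * A (s - a) \<partial>lborel)"
  proof -
    have "I = (\<integral>s. std_normal_density s * A s \<partial>lborel)"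
      unfolding I_def by (subst integral_density) auto
    also have "\<dots> = (\<integral>s. std_normal_density (- a + 1 * s) * A (- a + 1 * s) \<partial>lborel)"
      by (subst lborel_integral_real_affine[where c = 1 and t = "- a"]) auto
    finally show ?thesis by (simp add: normal_density_def)
  qed
  have J: "J = (\<integral>s. std_normal_density s * B s \<partial>lborel)"
    unfolding J_def by (subst integral_density) (auto simp: B)
  have pt: "2 * c * (normal_density a 1 s * A (s - a))
      \<le> c\<^sup>2 * exp (a\<^sup>2) * normal_density (2 * a) 1 s + K * (std_normal_density s * B s)" for s
  proof -
    define g where "g = std_normal_density s"
    define x where "x = normal_density a 1 s"
    have g: "g > 0" unfolding g_def by (rule normal_density_pos) simp
    have "2 * (c * x) * (g * A (s - a)) \<le> (c * x)\<^sup>2 + (g * A (s - a))\<^sup>2"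
      by (rule sum_squares_bound)
    also have "(g * A (s - a))\<^sup>2 \<le> g\<^sup>2 * (K * B s)"
      using AB[of "s - a"] by (simp add: power_mult_distrib mult_left_mono)
    also have "(c * x)\<^sup>2 = c\<^sup>2 * (exp (a\<^sup>2) * normal_density (2 * a) 1 s * g)"
      unfolding x_def g_def by (simp add: power_mult_distrib normal_density_shift_sq)
    finally have "g * (2 * c * (x * A (s - a)))
        \<le> g * (c\<^sup>2 * exp (a\<^sup>2) * normal_density (2 * a) 1 s + K * (g * B s))"
      by (simp add: algebra_simps power2_eq_square)
    then show ?thesis using g unfolding g_def x_def by simp
  qed
  have "2 * c * I = (\<integral>s. 2 * c * (normal_density a 1 s * A (s - a)) \<partial>lborel)"
    unfolding I by simp
  also have "\<dots> \<le> (\<integral>s. c\<^sup>2 * exp (a\<^sup>2) * normal_density (2 * a) 1 s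
                        + K * (std_normal_density s * B s) \<partial>lborel)"
    by (intro integral_mono pt Bochner_Integration.integrable_add integrable_mult_right int
          integrable_normal_density) (auto simp: A B)
  also have "\<dots> = c\<^sup>2 * exp (a\<^sup>2) + K * J"
    unfolding J by (subst Bochner_Integration.integral_add) (auto intro!: int simp: B)
  finally have "2 * c * I \<le> c\<^sup>2 * exp (a\<^sup>2) + K * J" .
  moreover have "c\<^sup>2 * exp (a\<^sup>2) = c * I"
    by (simp add: c_def power2_eq_square exp_minus)
  ultimately have "exp (a\<^sup>2) * (c * I) \<le> exp (a\<^sup>2) * (K * J)" by (simp add: mult.commute)
  also have "exp (a\<^sup>2) * (c * I) = I\<^sup>2"
    by (simp add: c_def power2_eq_square exp_minus)
  finally show ?thesis unfolding I_def J_def by simp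
qed

definition query_step :: "real \<Rightarrow> real \<Rightarrow> nat \<Rightarrow> ('a \<Rightarrow> real) \<Rightarrow> ('a hist \<Rightarrow> bool \<times> 'a)
                           \<Rightarrow> 'a hist \<Rightarrow> real \<Rightarrow> 'a hist" where
  "query_step \<sigma> \<alpha> T f A h s =
     (if n_main h \<ge> T then h
      else h @ [(fst (A h), snd (A h), f (snd (A h)) + noise_sd \<sigma> \<alpha> T (Suc (n_main h)) * s)])"

text \<open>Unlike \<^const>\<open>interact\<close>, this consumes the noise sequence from its head, so that a run
  can be resumed from an arbitrary history with fresh noise.\<close>

fun run_from :: "real \<Rightarrow> real \<Rightarrow> nat \<Rightarrow> ('a \<Rightarrow> real) \<Rightarrow> ('a hist \<Rightarrow> bool \<times> 'a)
                  \<Rightarrow> 'a hist \<Rightarrow> (nat \<Rightarrow> real) \<Rightarrow> nat \<Rightarrow> 'a hist" where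
  "run_from \<sigma> \<alpha> T f A h z 0 = h"
| "run_from \<sigma> \<alpha> T f A h z (Suc k) =
     run_from \<sigma> \<alpha> T f A (query_step \<sigma> \<alpha> T f A h (z 0)) (\<lambda>j. z (Suc j)) k"

lemma run_from_Suc_last:
  "run_from \<sigma> \<alpha> T f A h z (Suc k) = query_step \<sigma> \<alpha> T f A (run_from \<sigma> \<alpha> T f A h z k) (z k)"
proof (induction k arbitrary: h z)
  case (Suc k)
  show ?case
    by (subst run_from.simps, subst Suc.IH) simp
qed simp

lemma interact_eq_run_from: "interact \<sigma> \<alpha> T f alg u z k = run_from \<sigma> \<alpha> T f (alg u) [] z k"
proof (induction k)
  case (Suc k)
  then show ?case
    by (subst run_from_Suc_last) (simp add: query_step_def Let_def)
qed simp

lemma run_from_extends: "\<exists>xs. run_from \<sigma> \<alpha> T f A h z k = h @ xs"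
proof (induction k arbitrary: h z)
  case (Suc k)
  obtain xs where "run_from \<sigma> \<alpha> T f A h z (Suc k) = query_step \<sigma> \<alpha> T f A h (z 0) @ xs"
    using Suc[of "query_step \<sigma> \<alpha> T f A h (z 0)" "\<lambda>j. z (Suc j)"] by auto
  then show ?case by (auto simp: query_step_def)
qed auto

text \<open>Backward induction over the number \<open>k\<close> of remaining queries. The algorithm itself need not
  be measurable: only sections of the terminal losses \<open>\<Phi>\<^sub>1\<close>, \<open>\<Phi>\<^sub>2\<close> are integrated.
  At a common history the next observation is made to coincide by shifting the noise, and once
  \<open>m\<close> main evaluations are done the losses are already incompatible, so the more informative
  later queries never enter.\<close>

lemma two_point_backward_induction:
  fixes \<Phi>1 \<Phi>2 :: "'a hist \<Rightarrow> real" and f1 f2 :: "'a \<Rightarrow> real"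
  assumes rng: "\<And>h. 0 \<le> \<Phi>1 h" "\<And>h. \<Phi>1 h \<le> 1" "\<And>h. 0 \<le> \<Phi>2 h" "\<And>h. \<Phi>2 h \<le> 1"
    and leaf: "\<And>h xs ys. m \<le> n_main h \<Longrightarrow> n_main (h @ xs) = T \<Longrightarrow> n_main (h @ ys) = T
                 \<Longrightarrow> 1 \<le> \<Phi>1 (h @ xs) + \<Phi>2 (h @ ys)"
    and "m \<le> T" and \<eta>: "0 \<le> \<eta>"
    and sd: "\<And>t. t \<le> m \<Longrightarrow> 0 < noise_sd \<sigma> \<alpha> T t"
    and shift: "\<And>t p. t \<le> m \<Longrightarrow> ((f1 p - f2 p) / noise_sd \<sigma> \<alpha> T t)\<^sup>2 \<le> \<eta>"
    and "\<And>z. n_main (run_from \<sigma> \<alpha> T f1 A h z k) = T" "\<And>z. n_main (run_from \<sigma> \<alpha> T f2 A h z k) = T"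
    and "(\<lambda>z. \<Phi>1 (run_from \<sigma> \<alpha> T f1 A h z k)) \<in> borel_measurable normal_seq"
    and "(\<lambda>z. \<Phi>2 (run_from \<sigma> \<alpha> T f2 A h z k)) \<in> borel_measurable normal_seq"
  shows "(1 - (\<integral>z. \<Phi>1 (run_from \<sigma> \<alpha> T f1 A h z k) \<partial>normal_seq))\<^sup>2
          \<le> exp (real k * \<eta>) * (\<integral>z. \<Phi>2 (run_from \<sigma> \<alpha> T f2 A h z k) \<partial>normal_seq)"
  using assms(10-)
proof (induction k arbitrary: h)
  interpret S: prob_space normal_seq by (rule prob_space_normal_seq)
  have leaf_case: "(1 - (\<integral>z. \<Phi>1 (run_from \<sigma> \<alpha> T f1 A h z k) \<partial>normal_seq))\<^sup>2
          \<le> exp (real k * \<eta>) * (\<integral>z. \<Phi>2 (run_from \<sigma> \<alpha> T f2 A h z k) \<partial>normal_seq)"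
    if m: "m \<le> n_main h"
      and n1: "\<And>z. n_main (run_from \<sigma> \<alpha> T f1 A h z k) = T"
      and n2: "\<And>z. n_main (run_from \<sigma> \<alpha> T f2 A h z k) = T"
      and [measurable]: "(\<lambda>z. \<Phi>1 (run_from \<sigma> \<alpha> T f1 A h z k)) \<in> borel_measurable normal_seq"
        "(\<lambda>z. \<Phi>2 (run_from \<sigma> \<alpha> T f2 A h z k)) \<in> borel_measurable normal_seq" for h k
  proof -
    let ?r1 = "\<lambda>z. run_from \<sigma> \<alpha> T f1 A h z k" and ?r2 = "\<lambda>z. run_from \<sigma> \<alpha> T f2 A h z k"
    have i1: "integrable normal_seq (\<lambda>z. \<Phi>1 (?r1 z))" and i2: "integrable normal_seq (\<lambda>z. \<Phi>2 (?r2 z))"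
      by (auto intro!: S.integrable_const_bound[where B = 1] simp: rng)
    have sum: "1 \<le> \<Phi>1 (?r1 z) + \<Phi>2 (?r2 z)" for z
      using run_from_extends[of \<sigma> \<alpha> T f1 A h z k] run_from_extends[of \<sigma> \<alpha> T f2 A h z k]
        leaf[OF m] n1[of z] n2[of z] by metis
    have "(\<integral>z. 1 \<partial>normal_seq) \<le> (\<integral>z. \<Phi>1 (?r1 z) + \<Phi>2 (?r2 z) \<partial>normal_seq)"
      by (intro integral_mono sum Bochner_Integration.integrable_add i1 i2) simp
    then have le: "1 \<le> (\<integral>z. \<Phi>1 (?r1 z) \<partial>normal_seq) + (\<integral>z. \<Phi>2 (?r2 z) \<partial>normal_seq)"
      using i1 i2 by (simp add: S.prob_space)
    have "0 \<le> (\<integral>z. \<Phi>1 (?r1 z) \<partial>normal_seq)" "0 \<le> (\<integral>z. \<Phi>2 (?r2 z) \<partial>normal_seq)"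
      by (auto simp: rng)
    moreover have "(\<integral>z. \<Phi>1 (?r1 z) \<partial>normal_seq) \<le> 1"
      using S.integral_le_const[OF i1, of 1] by (simp add: rng)
    ultimately have "(1 - (\<integral>z. \<Phi>1 (?r1 z) \<partial>normal_seq))\<^sup>2 \<le> 1 * (\<integral>z. \<Phi>2 (?r2 z) \<partial>normal_seq)"
      unfolding power2_eq_square using le by (intro mult_mono) auto
    also have "\<dots> \<le> exp (real k * \<eta>) * (\<integral>z. \<Phi>2 (?r2 z) \<partial>normal_seq)"
      using \<open>0 \<le> (\<integral>z. \<Phi>2 (?r2 z) \<partial>normal_seq)\<close> \<eta> by (intro mult_right_mono) auto
    finally show ?thesis .
  qed
  {
    case 0
    then show ?case using leaf_case[of h 0] \<open>m \<le> T\<close> by simp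
  next
    case (Suc k)
    show ?case
    proof (cases "m \<le> n_main h")
      case True
      then show ?thesis using leaf_case[of h "Suc k"] Suc.prems by blast
    next
      case False
      define p where "p = snd (A h)"
      define d where "d = noise_sd \<sigma> \<alpha> T (Suc (n_main h))"
      define a where "a = (f1 p - f2 p) / d"
      define q1 where "q1 = query_step \<sigma> \<alpha> T f1 A h"
      define q2 where "q2 = query_step \<sigma> \<alpha> T f2 A h"
      have d: "d > 0" using False sd by (simp add: d_def)
      have a2: "a\<^sup>2 \<le> \<eta>" using False shift by (simp add: a_def d_def)
      have q: "q2 (s + a) = q1 s" for s
        using d by (simp add: q1_def q2_def query_step_def a_def flip: p_def d_def)
          (simp add: field_simps)
      define U1 where "U1 s = (\<integral>z. \<Phi>1 (run_from \<sigma> \<alpha> T f1 A (q1 s) z k) \<partial>normal_seq)" for s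
      define U2 where "U2 s = (\<integral>z. \<Phi>2 (run_from \<sigma> \<alpha> T f2 A (q2 s) z k) \<partial>normal_seq)" for s
      have run_case: "run_from \<sigma> \<alpha> T f1 A h (case_nat s z) (Suc k) = run_from \<sigma> \<alpha> T f1 A (q1 s) z k"
        "run_from \<sigma> \<alpha> T f2 A h (case_nat s z) (Suc k) = run_from \<sigma> \<alpha> T f2 A (q2 s) z k" for s z
        by (simp_all add: q1_def q2_def)
      have n1: "n_main (run_from \<sigma> \<alpha> T f1 A (q1 s) z k) = T"
        and n2: "n_main (run_from \<sigma> \<alpha> T f2 A (q2 s) z k) = T" for s z
        using Suc.prems(1)[of "case_nat s z"] Suc.prems(2)[of "case_nat s z"]
        by (simp_all only: run_case)
      note [measurable] = Suc.prems(3,4)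
      have [measurable]:
        "(\<lambda>\<omega>. \<Phi>1 (run_from \<sigma> \<alpha> T f1 A (q1 (fst \<omega>)) (snd \<omega>) k)) \<in> borel_measurable (std_normal \<Otimes>\<^sub>M normal_seq)"
        "(\<lambda>\<omega>. \<Phi>2 (run_from \<sigma> \<alpha> T f2 A (q2 (fst \<omega>)) (snd \<omega>) k)) \<in> borel_measurable (std_normal \<Otimes>\<^sub>M normal_seq)"
        using measurable_compose[OF _ Suc.prems(3),
            of "\<lambda>\<omega>. case_nat (fst \<omega>) (snd \<omega>)" "std_normal \<Otimes>\<^sub>M normal_seq"]
          measurable_compose[OF _ Suc.prems(4),
            of "\<lambda>\<omega>. case_nat (fst \<omega>) (snd \<omega>)" "std_normal \<Otimes>\<^sub>M normal_seq"]
        unfolding run_case by simp_all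
      have s1: "(\<lambda>z. \<Phi>1 (run_from \<sigma> \<alpha> T f1 A (q1 s) z k)) \<in> borel_measurable normal_seq"
        and s2: "(\<lambda>z. \<Phi>2 (run_from \<sigma> \<alpha> T f2 A (q2 s) z k)) \<in> borel_measurable normal_seq" for s
        using measurable_compose[OF _ Suc.prems(3), of "\<lambda>z. case_nat s z" "normal_seq"]
          measurable_compose[OF _ Suc.prems(4), of "\<lambda>z. case_nat s z" "normal_seq"]
        unfolding run_case by simp_all
      have "U1 \<in> borel_measurable std_normal" "U2 \<in> borel_measurable std_normal"
        unfolding U1_def U2_def
        by (intro S.borel_measurable_lebesgue_integral; simp add: case_prod_beta')+
      then have [measurable]: "U1 \<in> borel_measurable borel" "U2 \<in> borel_measurable borel"
        by simp_all
      have U: "0 \<le> U1 s" "U1 s \<le> 1" "0 \<le> U2 s" "U2 s \<le> 1" for s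
        unfolding U1_def U2_def using s1[of s] s2[of s]
        by (auto intro!: S.integral_le_const S.integrable_const_bound[where B = 1] simp: rng)
      have step: "(1 - U1 s)\<^sup>2 \<le> exp (real k * \<eta>) * U2 (s + a)" for s
        unfolding U1_def U2_def q
        using Suc.IH[of "q1 s"] n1[of s] n2[of "s + a"] s1[of s] s2[of "s + a"] by (simp add: q)
      have E1: "(\<integral>z. \<Phi>1 (run_from \<sigma> \<alpha> T f1 A h z (Suc k)) \<partial>normal_seq) = (\<integral>s. U1 s \<partial>std_normal)"
        and E2: "(\<integral>z. \<Phi>2 (run_from \<sigma> \<alpha> T f2 A h z (Suc k)) \<partial>normal_seq) = (\<integral>s. U2 s \<partial>std_normal)"
        unfolding U1_def U2_def run_case[symmetric]
        by (rule integral_normal_seq_Cons[where b = 1]; simp only: abs_of_nonneg rng Suc.prems)+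
      interpret G: prob_space std_normal by (rule prob_space_std_normal)
      have iU: "integrable std_normal U1"
        by (intro G.integrable_const_bound[where B = 1]) (auto simp: U)
      have "(1 - (\<integral>s. U1 s \<partial>std_normal))\<^sup>2 = (\<integral>s. 1 - U1 s \<partial>std_normal)\<^sup>2"
        using iU G.prob_space by simp
      also have "\<dots> \<le> exp (a\<^sup>2) * exp (real k * \<eta>) * (\<integral>s. U2 s \<partial>std_normal)"
        by (rule std_normal_shift_bound) (auto simp: U step)
      also have "\<dots> \<le> exp \<eta> * exp (real k * \<eta>) * (\<integral>s. U2 s \<partial>std_normal)"
        using a2 by (intro mult_right_mono) (auto simp: U)
      also have "exp \<eta> * exp (real k * \<eta>) = exp (real (Suc k) * \<eta>)"
        by (simp add: exp_add[symmetric] algebra_simps)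
      finally show ?thesis unfolding E1 E2 .
    qed
  }
qed

lemma regret_nonneg:
  assumes "\<And>p. f p \<le> (SUP x\<in>D. f x)"
  shows "0 \<le> regret D f T h"
  unfolding regret_def by (intro sum_nonneg) (simp add: assms)

lemma regret_ge_initial:
  assumes "\<And>p. f p \<le> (SUP x\<in>D. f x)" and "m \<le> T" "m \<le> n_main h"
  shows "(\<Sum>i<m. (SUP x\<in>D. f x) - f (main_points h ! i)) \<le> regret D f T (h @ xs)"
proof -
  have len: "length (main_points h) = n_main h"
    by (simp add: main_points_def n_main_def)
  have "(\<Sum>i<m. (SUP x\<in>D. f x) - f (main_points h ! i))
      = (\<Sum>i<m. (SUP x\<in>D. f x) - f (main_points (h @ xs) ! i))"
    using \<open>m \<le> n_main h\<close> by (intro sum.cong) (auto simp: main_points_def nth_append n_main_def)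
  also have "\<dots> \<le> regret D f T (h @ xs)"
    unfolding regret_def using assms by (intro sum_mono2) auto
  finally show ?thesis .
qed

lemma prob_space_seed: "prob_space (uniform_measure lborel {0..1 :: real})"
  by (rule prob_space_uniform_measure) auto

lemma two_point_regret_bound:
  fixes f1 f2 :: "'a \<Rightarrow> real"
  assumes valid: "valid_alg D k B \<sigma> \<alpha> T budget alg"
    and ball: "in_rkhs_ball k D B f1" "in_rkhs_ball k D B f2"
    and gap: "\<And>p. f1 p \<le> (SUP x\<in>D. f1 x)" "\<And>p. f2 p \<le> (SUP x\<in>D. f2 x)"
      "\<And>p. \<delta> \<le> ((SUP x\<in>D. f1 x) - f1 p) + ((SUP x\<in>D. f2 x) - f2 p)"
    and "\<delta> > 0" and m: "0 < m" "m \<le> T" and \<eta>: "0 \<le> \<eta>"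
    and sd: "\<And>t. t \<le> m \<Longrightarrow> 0 < noise_sd \<sigma> \<alpha> T t"
    and shift: "\<And>t p. t \<le> m \<Longrightarrow> ((f1 p - f2 p) / noise_sd \<sigma> \<alpha> T t)\<^sup>2 \<le> \<eta>"
    and K: "real (max_queries T budget) * \<eta> \<le> K"
  shows "\<exists>f\<in>{f1, f2}. ennreal (real m * \<delta> * exp (- K) / 8) \<le>
           (\<integral>\<^sup>+ \<omega>. ennreal (regret D f T (final_hist \<sigma> \<alpha> T budget f alg (fst \<omega>) (snd \<omega>)))
              \<partial>noise_space)"
proof -
  define N where "N = max_queries T budget"
  define b where "b = real m * \<delta>"
  define R where "R f \<omega> = regret D f T (final_hist \<sigma> \<alpha> T budget f alg (fst \<omega>) (snd \<omega>))" for f \<omega>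
  define \<Phi> where "\<Phi> f h = min 1 (regret D f T h / b)" for f h
  interpret S: prob_space normal_seq by (rule prob_space_normal_seq)
  interpret U: prob_space "uniform_measure lborel {0..1 :: real}" by (rule prob_space_seed)
  interpret P: pair_prob_space "uniform_measure lborel {0..1 :: real}" normal_seq ..
  have b: "b > 0" using m \<open>\<delta> > 0\<close> by (simp add: b_def)
  have R_meas: "R f \<in> borel_measurable noise_space" and nm: "n_main (final_hist \<sigma> \<alpha> T budget f alg u z) = T"
    if "f \<in> {f1, f2}" for f u z
    using valid ball that by (auto simp: valid_alg_def R_def[abs_def] case_prod_beta')
  have rng: "0 \<le> \<Phi> f h" "\<Phi> f h \<le> 1" if "f \<in> {f1, f2}" for f h
    using that regret_nonneg[of f D T h] gap b by (auto simp: \<Phi>_def)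
  have leaf: "1 \<le> \<Phi> f1 (h @ xs) + \<Phi> f2 (h @ ys)" if h: "m \<le> n_main h" for h xs ys
  proof -
    have "b = (\<Sum>i<m. \<delta>)" by (simp add: b_def)
    also have "\<dots> \<le> (\<Sum>i<m. ((SUP x\<in>D. f1 x) - f1 (main_points h ! i))
                            + ((SUP x\<in>D. f2 x) - f2 (main_points h ! i)))"
      by (intro sum_mono gap)
    also have "\<dots> \<le> regret D f1 T (h @ xs) + regret D f2 T (h @ ys)"
      unfolding sum.distrib by (intro add_mono regret_ge_initial gap m h)
    finally have "1 \<le> regret D f1 T (h @ xs) / b + regret D f2 T (h @ ys) / b"
      using b by (simp add: field_simps)
    moreover have "0 \<le> \<Phi> f1 (h @ xs)" "0 \<le> \<Phi> f2 (h @ ys)" by (simp_all add: rng)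
    ultimately show ?thesis unfolding \<Phi>_def by linarith
  qed
  have fh: "final_hist \<sigma> \<alpha> T budget f alg u z = run_from \<sigma> \<alpha> T f (alg u) [] z N" for f u z
    by (simp add: final_hist_def interact_eq_run_from N_def)
  define V where "V f \<omega> = \<Phi> f (final_hist \<sigma> \<alpha> T budget f alg (fst \<omega>) (snd \<omega>))" for f \<omega>
  have V_meas: "V f \<in> borel_measurable noise_space" if "f \<in> {f1, f2}" for f
    using R_meas[OF that] unfolding V_def[abs_def] \<Phi>_def R_def[abs_def] by measurable
  then have V_pair: "V f \<in> borel_measurable (uniform_measure lborel {0..1} \<Otimes>\<^sub>M normal_seq)"
    if "f \<in> {f1, f2}" for f using that by (simp add: noise_space_def)
  have V_sec: "(\<lambda>z. V f (u, z)) \<in> borel_measurable normal_seq" if "f \<in> {f1, f2}" for f u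
    using measurable_Pair2[OF V_pair[OF that], of u] by simp
  have V_rng: "0 \<le> V f \<omega>" "V f \<omega> \<le> 1" if "f \<in> {f1, f2}" for f \<omega>
    using rng[OF that] by (auto simp: V_def)
  have V_int: "integrable normal_seq (\<lambda>z. V f (u, z))" if "f \<in> {f1, f2}" for f u
    by (intro S.integrable_const_bound[where B = 1] V_sec that) (auto simp: V_rng[OF that])
  have sections: "exp (- K) / 4 \<le> (\<integral>z. V f1 (u, z) \<partial>normal_seq) + (\<integral>z. V f2 (u, z) \<partial>normal_seq)" for u
  proof -
    let ?E1 = "\<integral>z. V f1 (u, z) \<partial>normal_seq" and ?E2 = "\<integral>z. V f2 (u, z) \<partial>normal_seq"
    have "(1 - ?E1)\<^sup>2 \<le> exp (real N * \<eta>) * ?E2"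
      unfolding V_def fst_conv snd_conv fh
      by (rule two_point_backward_induction[where m = m])
         (use V_sec[of _ u] nm m \<eta> sd shift rng leaf in \<open>auto simp: V_def fh\<close>)
    also have "\<dots> \<le> exp K * ?E2"
      using K by (intro mult_right_mono) (auto simp: N_def V_rng)
    finally have sq: "(1 - ?E1)\<^sup>2 \<le> exp K * ?E2" .
    have nn: "0 \<le> ?E1" "0 \<le> ?E2" by (auto simp: V_rng)
    have "0 \<le> real N * \<eta>" using \<eta> by simp
    then have "0 \<le> K" using K unfolding N_def by linarith
    show ?thesis
    proof (cases "?E1 \<le> 1 / 2")
      case True
      then have "(1 / 2)\<^sup>2 \<le> (1 - ?E1)\<^sup>2" by (intro power_mono) auto
      then have "exp (- K) * (1 / 4) \<le> exp (- K) * (exp K * ?E2)"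
        using sq by (intro mult_left_mono) (auto simp: power2_eq_square)
      also have "\<dots> = ?E2" by (simp add: exp_minus)
      finally show ?thesis using nn by simp
    next
      case False
      moreover have "exp (- K) \<le> 1" using \<open>0 \<le> K\<close> by simp
      ultimately show ?thesis using nn by linarith
    qed
  qed
  have fst_eq: "(\<integral>\<^sup>+\<omega>. ennreal (V f \<omega>) \<partial>noise_space)
      = (\<integral>\<^sup>+u. ennreal (\<integral>z. V f (u, z) \<partial>normal_seq) \<partial>uniform_measure lborel {0..1})"
    if "f \<in> {f1, f2}" for f
  proof -
    have "(\<integral>\<^sup>+\<omega>. ennreal (V f \<omega>) \<partial>noise_space)
        = (\<integral>\<^sup>+u. (\<integral>\<^sup>+z. ennreal (V f (u, z)) \<partial>normal_seq) \<partial>uniform_measure lborel {0..1})"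
      unfolding noise_space_def using V_pair[OF that]
      by (subst S.nn_integral_fst[symmetric]) auto
    then show ?thesis
      by (simp add: nn_integral_eq_integral[OF V_int[OF that]] V_rng[OF that])
  qed
  have inner_meas: "(\<lambda>u. \<integral>z. V f (u, z) \<partial>normal_seq) \<in> borel_measurable (uniform_measure lborel {0..1})"
    if "f \<in> {f1, f2}" for f
    using V_pair[OF that] by (intro S.borel_measurable_lebesgue_integral) (simp add: case_prod_beta')
  have "ennreal (exp (- K) / 4) = (\<integral>\<^sup>+u. ennreal (exp (- K) / 4) \<partial>uniform_measure lborel {0..1 :: real})"
    by (simp add: U.emeasure_space_1)
  also have "\<dots> \<le> (\<integral>\<^sup>+u. ennreal (\<integral>z. V f1 (u, z) \<partial>normal_seq) + ennreal (\<integral>z. V f2 (u, z) \<partial>normal_seq)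
                    \<partial>uniform_measure lborel {0..1})"
    using sections by (intro nn_integral_mono) (simp add: V_rng flip: ennreal_plus)
  also have "\<dots> = (\<integral>\<^sup>+\<omega>. ennreal (V f1 \<omega>) \<partial>noise_space) + (\<integral>\<^sup>+\<omega>. ennreal (V f2 \<omega>) \<partial>noise_space)"
    using inner_meas by (subst nn_integral_add) (auto simp: fst_eq)
  finally have sum: "ennreal (exp (- K) / 4)
      \<le> (\<integral>\<^sup>+\<omega>. ennreal (V f1 \<omega>) \<partial>noise_space) + (\<integral>\<^sup>+\<omega>. ennreal (V f2 \<omega>) \<partial>noise_space)" .
  have "\<exists>f\<in>{f1, f2}. ennreal (exp (- K) / 8) \<le> (\<integral>\<^sup>+\<omega>. ennreal (V f \<omega>) \<partial>noise_space)"
  proof (rule ccontr)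
    assume "\<not> ?thesis"
    then have "(\<integral>\<^sup>+\<omega>. ennreal (V f1 \<omega>) \<partial>noise_space) + (\<integral>\<^sup>+\<omega>. ennreal (V f2 \<omega>) \<partial>noise_space)
        < ennreal (exp (- K) / 8) + ennreal (exp (- K) / 8)"
      by (intro add_strict_mono) (auto simp: not_le)
    also have "\<dots> = ennreal (exp (- K) / 4)" by (simp flip: ennreal_plus)
    finally show False using sum by simp
  qed
  then obtain f where f: "f \<in> {f1, f2}"
    and fV: "ennreal (exp (- K) / 8) \<le> (\<integral>\<^sup>+\<omega>. ennreal (V f \<omega>) \<partial>noise_space)" by blast
  have "ennreal (b * exp (- K) / 8) = ennreal b * ennreal (exp (- K) / 8)"
    using b by (simp flip: ennreal_mult)
  also have "\<dots> \<le> ennreal b * (\<integral>\<^sup>+\<omega>. ennreal (V f \<omega>) \<partial>noise_space)"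
    by (intro mult_left_mono fV) simp
  also have "\<dots> = (\<integral>\<^sup>+\<omega>. ennreal b * ennreal (V f \<omega>) \<partial>noise_space)"
    using V_meas[OF f] by (subst nn_integral_cmult) auto
  also have "\<dots> \<le> (\<integral>\<^sup>+\<omega>. ennreal (R f \<omega>) \<partial>noise_space)"
  proof (rule nn_integral_mono)
    fix \<omega>
    have "b * V f \<omega> \<le> b * (R f \<omega> / b)"
      using b by (intro mult_left_mono) (auto simp: V_def \<Phi>_def R_def)
    then have "b * V f \<omega> \<le> R f \<omega>" using b by simp
    then show "ennreal b * ennreal (V f \<omega>) \<le> ennreal (R f \<omega>)"
      using b V_rng[OF f] by (simp add: ennreal_leI flip: ennreal_mult)
  qed
  finally show ?thesis using f unfolding b_def R_def by blast
qed

lemma kernel_section_in_rkhs_ball: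
  assumes "y \<in> D" and "\<bar>c\<bar> * sqrt (k y y) \<le> B"
  shows "in_rkhs_ball k D B (\<lambda>x. c * k y x)"
  unfolding in_rkhs_ball_def
proof (intro exI[of _ "\<lambda>_. [(c, y)]"] exI[of _ "\<bar>c\<bar> * sqrt (k y y)"] conjI)
  have "pre_norm k (pre_diff [(c, y)] [(c, y)]) = 0"
    by (simp add: pre_norm_def pre_diff_def lessThan_Suc)
  then show "\<forall>e>0. \<exists>N. \<forall>m\<ge>N. \<forall>n\<ge>N. pre_norm k (pre_diff [(c, y)] [(c, y)]) < e"
    by simp
  have "pre_norm k [(c, y)] = \<bar>c\<bar> * sqrt (k y y)"
    by (simp add: pre_norm_def real_sqrt_mult)
  then show "(\<lambda>n. pre_norm k [(c, y)]) \<longlonglongrightarrow> \<bar>c\<bar> * sqrt (k y y)" by simp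
qed (use assms in \<open>auto simp: pre_eval_def\<close>)

text \<open>The two hard instances are kernel sections of norm \<open>B\<close> centred at distinct points; any query
  point is at distance at least half their separation from one of the centres.\<close>

theorem theorem5p2:
  fixes D :: "(real ^ 'd) set" and Mk l B \<sigma> \<alpha> C :: real
  assumes "compact D" and "convex D" and "\<exists>x\<in>D. \<exists>y\<in>D. x \<noteq> y"
    and "Mk > 0" and "l > 0" and "B > 0" and "\<sigma> > 0" and "\<alpha> > 1" and "C > 0"
  shows "\<exists>c>0. \<exists>T0. \<forall>T\<ge>T0. \<forall>alg.
           valid_alg D (se_kernel Mk l) B \<sigma> \<alpha> T (C * real T powr (\<alpha> / (\<alpha> + 1))) alg \<longrightarrow>
           (\<exists>f. in_rkhs_ball (se_kernel Mk l) D B f \<and>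
                (\<integral>\<^sup>+ \<omega>. ennreal (regret D f T
                   (final_hist \<sigma> \<alpha> T (C * real T powr (\<alpha> / (\<alpha> + 1))) f alg (fst \<omega>) (snd \<omega>)))
                 \<partial>noise_space) \<ge> ennreal (c * real T))"
proof -
  obtain x y where xy: "x \<in> D" "y \<in> D" "x \<noteq> y" using assms by blast
  define r where "r = norm (x - y)"
  define F where "F = B * Mk"
  define f where "f c p = F * exp (- (norm (p - c))\<^sup>2 / (2 * l\<^sup>2))" for c p :: "real ^ 'd"
  define \<delta> where "\<delta> = F * (1 - exp (- (r / 2)\<^sup>2 / (2 * l\<^sup>2)))"
  define K where "K = (1 + C) * F\<^sup>2 * 2 powr \<alpha> / \<sigma>\<^sup>2"
  have r: "r > 0" and F: "F > 0" using xy assms by (simp_all add: r_def F_def)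
  have \<delta>: "\<delta> > 0" using r F \<open>l > 0\<close> by (simp add: \<delta>_def)
  have f_rng: "0 \<le> f c p" "f c p \<le> F" for c p
    using F by (auto simp: f_def mult_left_le)
  have f_max: "(SUP p\<in>D. f c p) = F" if "c \<in> D" for c
    by (rule cSup_eq_maximum) (use that f_rng in \<open>auto simp: f_def intro!: image_eqI[where x = c]\<close>)
  have f_ball: "in_rkhs_ball (se_kernel Mk l) D B (f c)" if "c \<in> D" for c
  proof -
    have "f c = (\<lambda>p. B / Mk * se_kernel Mk l c p)"
      using \<open>Mk > 0\<close> by (auto simp: f_def F_def se_kernel_def power2_eq_square)
    moreover have "\<bar>B / Mk\<bar> * sqrt (se_kernel Mk l c c) \<le> B"
      using \<open>Mk > 0\<close> \<open>B > 0\<close> by (simp add: se_kernel_def)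
    ultimately show ?thesis
      using kernel_section_in_rkhs_ball[where k = "se_kernel Mk l", OF that] by metis
  qed
  have far: "f c p \<le> F - \<delta>" if "r / 2 \<le> norm (p - c)" for c p
  proof -
    have "(r / 2)\<^sup>2 \<le> (norm (p - c))\<^sup>2" using that r by (intro power_mono) auto
    then have "exp (- (norm (p - c))\<^sup>2 / (2 * l\<^sup>2)) \<le> exp (- (r / 2)\<^sup>2 / (2 * l\<^sup>2))"
      using \<open>l > 0\<close> by (simp add: divide_right_mono)
    then have "f c p \<le> F * exp (- (r / 2)\<^sup>2 / (2 * l\<^sup>2))"
      unfolding f_def using F by (intro mult_left_mono) auto
    then show ?thesis by (simp add: \<delta>_def algebra_simps)
  qed
  have gap: "\<delta> \<le> (F - f x p) + (F - f y p)" for p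
  proof -
    have "r \<le> norm (p - x) + norm (p - y)"
      unfolding r_def using norm_triangle_ineq4[of "p - y" "p - x"] by simp
    then have "r / 2 \<le> norm (p - x) \<or> r / 2 \<le> norm (p - y)" by linarith
    then show ?thesis using far[of p x] far[of p y] f_rng(2)[of x p] f_rng(2)[of y p] by linarith
  qed
  define c where "c = \<delta> * exp (- K) / 24"
  have "\<exists>g. in_rkhs_ball (se_kernel Mk l) D B g \<and>
            ennreal (c * real T) \<le> (\<integral>\<^sup>+ \<omega>. ennreal (regret D g T
               (final_hist \<sigma> \<alpha> T budget g alg (fst \<omega>) (snd \<omega>))) \<partial>noise_space)"
    if T: "2 \<le> T" and budget: "budget = C * real T powr (\<alpha> / (\<alpha> + 1))"
      and valid: "valid_alg D (se_kernel Mk l) B \<sigma> \<alpha> T budget alg" for T alg budget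
  proof -
    define m where "m = T div 2"
    define v where "v = \<sigma>\<^sup>2 * (real T / 2) powr \<alpha>"
    have "0 < m" "m \<le> T" "T \<le> 3 * m" "2 * m \<le> T" using T unfolding m_def by presburger+
    then have m: "0 < m" "m \<le> T" "real T \<le> 3 * real m" "2 * m \<le> T" by linarith+
    have v: "v > 0" using T \<open>\<sigma> > 0\<close> by (simp add: v_def)
    have var: "v \<le> \<sigma>\<^sup>2 * (1 + (real T - real t) powr \<alpha>)" if "t \<le> m" for t
    proof -
      have "real t \<le> real m" using that by simp
      then have "real T / 2 \<le> real T - real t" using m(4) by linarith
      then have "(real T / 2) powr \<alpha> \<le> (real T - real t) powr \<alpha>"
        using \<open>\<alpha> > 1\<close> by (intro powr_mono2) auto
      then show ?thesis unfolding v_def by (intro mult_left_mono) auto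
    qed
    have sd: "0 < noise_sd \<sigma> \<alpha> T t" "v \<le> (noise_sd \<sigma> \<alpha> T t)\<^sup>2" if "t \<le> m" for t
      using var[OF that] v by (simp_all add: noise_sd_def)
    have shift: "((f x p - f y p) / noise_sd \<sigma> \<alpha> T t)\<^sup>2 \<le> F\<^sup>2 / v" if "t \<le> m" for t p
    proof -
      have "\<bar>f x p - f y p\<bar> \<le> \<bar>F\<bar>"
        using f_rng(1)[of x p] f_rng(1)[of y p] f_rng(2)[of x p] f_rng(2)[of y p] by linarith
      then have "(f x p - f y p)\<^sup>2 \<le> F\<^sup>2" by (simp add: abs_le_square_iff)
      then show ?thesis
        unfolding power_divide using sd[OF that] v by (intro frac_le) auto
    qed
    have "real T powr (\<alpha> / (\<alpha> + 1)) \<le> real T powr 1"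
      using T \<open>\<alpha> > 1\<close> by (intro powr_mono) auto
    then have "budget \<le> C * real T"
      unfolding budget using T \<open>C > 0\<close> by (intro mult_left_mono) auto
    moreover have "0 \<le> budget" unfolding budget using \<open>C > 0\<close> by simp
    then have "real (nat \<lfloor>budget\<rfloor>) \<le> budget" by (simp add: of_nat_floor)
    ultimately have "real (max_queries T budget) \<le> (1 + C) * real T"
      unfolding max_queries_def by (simp add: algebra_simps)
    also have "real T = real T powr 1" using T by simp
    also have "real T powr 1 \<le> real T powr \<alpha>" using T \<open>\<alpha> > 1\<close> by (intro powr_mono) auto
    finally have "real (max_queries T budget) \<le> (1 + C) * real T powr \<alpha>"
      using \<open>C > 0\<close> by simp
    then have "real (max_queries T budget) * (F\<^sup>2 / v) \<le> (1 + C) * real T powr \<alpha> * (F\<^sup>2 / v)"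
      using v by (intro mult_right_mono) auto
    also have "\<dots> = K"
      using T \<open>\<sigma> > 0\<close> by (simp add: K_def v_def powr_divide field_simps)
    finally have queries: "real (max_queries T budget) * (F\<^sup>2 / v) \<le> K" .
    have "\<exists>g\<in>{f x, f y}. ennreal (real m * \<delta> * exp (- K) / 8) \<le>
           (\<integral>\<^sup>+ \<omega>. ennreal (regret D g T (final_hist \<sigma> \<alpha> T budget g alg (fst \<omega>) (snd \<omega>)))
              \<partial>noise_space)"
      by (rule two_point_regret_bound[OF valid, where \<eta> = "F\<^sup>2 / v"])
         (use v gap queries in \<open>simp_all add: f_max xy f_ball f_rng \<delta> m sd shift\<close>)
    moreover have "c * real T \<le> real m * \<delta> * exp (- K) / 8"
      using mult_left_mono[OF m(3), of c] \<delta> by (simp add: c_def field_simps)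
    ultimately show ?thesis using xy f_ball by (blast intro: order_trans ennreal_leI)
  qed
  moreover have "c > 0" using \<delta> by (simp add: c_def)
  ultimately show ?thesis by blast
qed

end
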